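(* Let $X,Y$ be sets, $L\subset\mathcal{F}(X)$, let $f\in\mathcal{F}(X)$ be an $L$-convex function, and let $u:Y\to X$ be a map. Then for every $x\in Y$, $$\{v\circ u: v\in\partial_L f(u(x))\}\subset\partial_{L\circ u}(f\circ u)(x),$$ where $L\circ u=\{l\circ u: l\in L\}$. Furthermore, if $u$ is onto the domain of $f$, i.e. $u(Y)=\operatorname{dom} f$, then equality holds: $$\{v\circ u: v\in\partial_L f(u(x))\}=\partial_{L\circ u}(f\circ u)(x)\quad\text{for every }x\in Y.$$
   Context: $\mathcal{F}(X)$ is the set of all functions $f:X\to\mathbb{R}\cup\{+\infty\}$ together with the function identically $-\infty$. Families $L$ of elementary functions consist of real-valued functions on $X$. $\operatorname{dom} f=\{x\in X: f(x)<+\infty\}$. A function $f$ is $L$-convex if it is the pointwise supremum of some subset of $L$. For a set $Z$, a family $M$ of real-valued functions on $Z$, and $g\in\mathcal{F}(Z)$, the $M$-subdifferential of $g$ at $z\in Z$ is $\partial_M g(z)=\{m\in M: g(y)\ge g(z)+m(y)-m(z)\ \forall y\in Z\}$. *)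

theory Defs
  imports "HOL-Library.Extended_Real"
begin

text \<open>
  The ground sets are rendered as types. Elementary functions are real-valued by typing,
  and are embedded into the extended reals by \<open>ereal\<close>.
\<close>

definition ext_functions :: "('x \<Rightarrow> ereal) set" where
  "ext_functions = {f. \<forall>x. f x \<noteq> -\<infinity>} \<union> {\<lambda>_. -\<infinity>}"

definition eff_dom :: "('x \<Rightarrow> ereal) \<Rightarrow> 'x set" where
  "eff_dom f = {x. f x < \<infinity>}"

text \<open>The subset may be empty, in which case the supremum is identically \<open>-\<infinity>\<close>.\<close>

definition L_convex :: "('x \<Rightarrow> real) set \<Rightarrow> ('x \<Rightarrow> ereal) \<Rightarrow> bool" where
  "L_convex L f \<longleftrightarrow> (\<exists>S \<subseteq> L. \<forall>x. f x = (SUP l\<in>S. ereal (l x)))"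

text \<open>
  Since \<open>m\<close> is real-valued, no sum of opposite infinities occurs in the defining inequality.
\<close>

definition subdifferential ::
  "('z \<Rightarrow> real) set \<Rightarrow> ('z \<Rightarrow> ereal) \<Rightarrow> 'z \<Rightarrow> ('z \<Rightarrow> real) set" where
  "subdifferential M g z = {m \<in> M. \<forall>y. g y \<ge> g z + ereal (m y) - ereal (m z)}"

definition comp_family :: "('x \<Rightarrow> real) set \<Rightarrow> ('y \<Rightarrow> 'x) \<Rightarrow> ('y \<Rightarrow> real) set" where
  "comp_family L u = {l \<circ> u | l. l \<in> L}"

end

theory Submission
  imports Defs
begin

text \<open>The subgradient inequality for \<open>v \<circ> u\<close> at \<open>x\<close> is the one
  for \<open>v\<close> at \<open>u x\<close>, tested only at points of \<open>range u\<close>;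
  restricting the test points gives the inclusion. Conversely, if \<open>range u\<close> covers the
  domain, the points left untested have \<open>f = \<infinity>\<close> and impose nothing
  (\<open>subdifferential_comp_lift\<close>).\<close>

lemma subdifferential_comp:
  assumes "v \<in> subdifferential L f (u x)"
  shows "v \<circ> u \<in> subdifferential (comp_family L u) (f \<circ> u) x"
  using assms by (auto simp: subdifferential_def comp_family_def)

text \<open>Off the effective domain the subgradient inequality is vacuous, so it only has to be
  checked at points of the form \<open>u y\<close>.\<close>

lemma subdifferential_comp_lift:
  assumes onto: "eff_dom f \<subseteq> range u"
    and m: "m \<in> subdifferential (comp_family L u) (f \<circ> u) x"
  obtains v where "v \<in> subdifferential L f (u x)" "m = v \<circ> u"
proof -
  \<comment> \<open>Several \<open>v\<close> in \<open>L\<close> may induce the same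
    \<open>m\<close>; any of them serves, as the inequality at points \<open>u y\<close> sees
    \<open>v\<close> only through \<open>m\<close>.\<close>
  from m obtain v where v: "v \<in> L" "m = v \<circ> u"
    and ineq: "\<And>y. f (u x) + ereal (v (u y)) - ereal (v (u x)) \<le> f (u y)"
    by (auto simp: subdifferential_def comp_family_def)
  have "f (u x) + ereal (v z) - ereal (v (u x)) \<le> f z" for z
  proof (cases "z \<in> eff_dom f")
    case True
    with onto ineq show ?thesis by blast
  next
    case False
    \<comment> \<open>Here \<open>f z\<close> is the top of \<open>ereal\<close>, so the bound holds
      even when \<open>f (u x) = \<infinity>\<close>.\<close>
    then show ?thesis by (simp add: eff_dom_def)
  qed
  with v have "v \<in> subdifferential L f (u x)"
    by (simp add: subdifferential_def)
  with v(2) show thesis by (rule that[rotated])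
qed

theorem proposition11:
  fixes L :: "('x \<Rightarrow> real) set" and f :: "'x \<Rightarrow> ereal" and u :: "'y \<Rightarrow> 'x"
  assumes "f \<in> ext_functions"
    and "L_convex L f"
  shows "(\<forall>x. {v \<circ> u | v. v \<in> subdifferential L f (u x)}
              \<subseteq> subdifferential (comp_family L u) (f \<circ> u) x)
       \<and> (range u = eff_dom f \<longrightarrow>
            (\<forall>x. {v \<circ> u | v. v \<in> subdifferential L f (u x)}
               = subdifferential (comp_family L u) (f \<circ> u) x))"
proof -
  have sub: "{v \<circ> u | v. v \<in> subdifferential L f (u x)}
      \<subseteq> subdifferential (comp_family L u) (f \<circ> u) x" for x
    by (auto intro: subdifferential_comp)
  have "subdifferential (comp_family L u) (f \<circ> u) x
      \<subseteq> {v \<circ> u | v. v \<in> subdifferential L f (u x)}" if "range u = eff_dom f" for x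
    using that by (auto elim!: subdifferential_comp_lift[rotated])
  with sub show ?thesis by (simp add: subset_antisym)
qed

end
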